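(* For every finite set $X$, the linear map $\Gamma:\mathbb T_X\to\mathbb T_X\otimes\mathbb T_X$ defined on topologies $\mathcal T$ on $X$ by $$\Gamma(\mathcal T)=\sum_{\mathcal T'\ \mathcal T\text{-admissible}}\mathcal T'\otimes\mathcal T/\mathcal T'$$ is coassociative: $(\Gamma\otimes\mathrm{Id})\Gamma=(\mathrm{Id}\otimes\Gamma)\Gamma$.
   Context: For a finite set $X$, $\mathbb T_X$ denotes the vector space (over a field $K$) freely generated by the topologies on $X$. For a topology $\mathcal T$ on $X$, $x\le_{\mathcal T}y$ iff every open set containing $x$ contains $y$ (topologies correspond bijectively to quasi-orders, open sets being final segments); $x\sim_{\mathcal T}y$ iff $x\le_{\mathcal T}y$ and $y\le_{\mathcal T}x$. Write $\mathcal T'\prec\mathcal T$ when every $\mathcal T$-open set is $\mathcal T'$-open. For $\mathcal T'\prec\mathcal T$, $\mathcal T/\mathcal T'$ is the topology on $X$ whose quasi-order is the transitive closure of $x\,\mathcal R\,y\iff(x\le_{\mathcal T}y\text{ or }y\le_{\mathcal T'}x)$. For $Y\subset X$, $\mathcal T|_Y=\{Z\cap Y:Z\in\mathcal T\}$; $Y$ is $\mathcal T$-connected if $(Y,\mathcal T|_Y)$ is connected. $\mathcal T'$ is $\mathcal T$-admissible if $\mathcal T'\prec\mathcal T$, $\mathcal T'|_Y=\mathcal T|_Y$ for every $\mathcal T'$-connected $Y\subset X$, and $x\sim_{\mathcal T/\mathcal T'}y\iff x\sim_{\mathcal T'/\mathcal T'}y$ for all $x,y$. *)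

theory Defs
  imports "HOL-Analysis.Analysis" "HOL-Library.Poly_Mapping"
begin

section \<open>Free vector spaces and their tensor products\<close>

text \<open>
  The free \<open>'k\<close>-vector space on a set \<open>S\<close> consists of the finitely supported functions
  with support in \<open>S\<close>; a basis element \<open>s\<close> is \<open>Poly_Mapping.single s 1\<close>.
\<close>

definition free_vs :: "'b set \<Rightarrow> ('b \<Rightarrow>\<^sub>0 'k::field) set" where
  "free_vs S = {v. Poly_Mapping.keys v \<subseteq> S}"

abbreviation basis_elt :: "'b \<Rightarrow> ('b \<Rightarrow>\<^sub>0 'k::field)" where
  "basis_elt b \<equiv> Poly_Mapping.single b 1"

definition fscale :: "'k::field \<Rightarrow> ('b \<Rightarrow>\<^sub>0 'k) \<Rightarrow> ('b \<Rightarrow>\<^sub>0 'k)" where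
  "fscale c v = Poly_Mapping.map ((*) c) v"

definition lin_ext :: "('b \<Rightarrow> ('c \<Rightarrow>\<^sub>0 'k::field)) \<Rightarrow> ('b \<Rightarrow>\<^sub>0 'k) \<Rightarrow> ('c \<Rightarrow>\<^sub>0 'k)" where
  "lin_ext f v = (\<Sum>b\<in>Poly_Mapping.keys v. fscale (Poly_Mapping.lookup v b) (f b))"

text \<open>
  The tensor product of the free vector spaces on \<open>S\<close> and \<open>S'\<close> is the free vector space on
  \<open>S \<times> S'\<close>, with the pure tensors below (lemma \<open>tensor_universal\<close> is the universal property).
  The map \<open>f \<otimes> g\<close> is determined by its values on the basis
  (lemma \<open>tensor_map_tensor\<close>: it sends \<open>u \<otimes> v\<close> to \<open>f u \<otimes> g v\<close> for linear \<open>f\<close>, \<open>g\<close>).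
\<close>

definition tensor :: "('b \<Rightarrow>\<^sub>0 'k::field) \<Rightarrow> ('c \<Rightarrow>\<^sub>0 'k) \<Rightarrow> ('b \<times> 'c \<Rightarrow>\<^sub>0 'k)"
    (infixr \<open>\<otimes>\<^sub>v\<close> 70) where
  "u \<otimes>\<^sub>v v = (\<Sum>b\<in>Poly_Mapping.keys u. \<Sum>c\<in>Poly_Mapping.keys v.
       Poly_Mapping.single (b, c) (Poly_Mapping.lookup u b * Poly_Mapping.lookup v c))"

definition tensor_map ::
    "(('b \<Rightarrow>\<^sub>0 'k::field) \<Rightarrow> ('d \<Rightarrow>\<^sub>0 'k)) \<Rightarrow> (('c \<Rightarrow>\<^sub>0 'k) \<Rightarrow> ('e \<Rightarrow>\<^sub>0 'k)) \<Rightarrow>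
     ('b \<times> 'c \<Rightarrow>\<^sub>0 'k) \<Rightarrow> ('d \<times> 'e \<Rightarrow>\<^sub>0 'k)" where
  "tensor_map f g = lin_ext (\<lambda>(b, c). f (basis_elt b) \<otimes>\<^sub>v g (basis_elt c))"

text \<open>The canonical isomorphism \<open>(U \<otimes> V) \<otimes> W \<cong> U \<otimes> (V \<otimes> W)\<close>.\<close>

definition tensor_assoc :: "(('b \<times> 'c) \<times> 'd \<Rightarrow>\<^sub>0 'k::field) \<Rightarrow> ('b \<times> 'c \<times> 'd \<Rightarrow>\<^sub>0 'k)" where
  "tensor_assoc = lin_ext (\<lambda>((b, c), d). basis_elt (b, c, d))"

lemma lookup_fscale [simp]: "Poly_Mapping.lookup (fscale c v) b = c * Poly_Mapping.lookup v b"
  by (simp add: fscale_def map.rep_eq when_def)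

lemma vector_space_fscale: "vector_space (fscale :: 'k::field \<Rightarrow> ('b \<Rightarrow>\<^sub>0 'k) \<Rightarrow> _)"
  by unfold_locales (auto intro!: poly_mapping_eqI simp: lookup_add algebra_simps)

lemma linear_sum_keys:
  fixes s :: "'k::field \<Rightarrow> 'w::ab_group_add \<Rightarrow> 'w" and f :: "'b \<Rightarrow> 'w"
  assumes "vector_space s"
  shows "Vector_Spaces.linear fscale s
           (\<lambda>v. \<Sum>b\<in>Poly_Mapping.keys v. s (Poly_Mapping.lookup v b) (f b))"
proof -
  interpret V: vector_space s by fact
  have *: "(\<Sum>b\<in>Poly_Mapping.keys v. s (Poly_Mapping.lookup v b) (f b))
      = (\<Sum>b\<in>A. s (Poly_Mapping.lookup v b) (f b))"
    if "finite A" "Poly_Mapping.keys v \<subseteq> A" for v :: "'b \<Rightarrow>\<^sub>0 'k" and A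
    by (rule sum.mono_neutral_left) (use that in \<open>auto simp: in_keys_iff\<close>)
  show ?thesis
  proof (intro Vector_Spaces.linear_iff[THEN iffD2] conjI allI vector_space_fscale assms)
    fix u v :: "'b \<Rightarrow>\<^sub>0 'k"
    let ?A = "Poly_Mapping.keys u \<union> Poly_Mapping.keys v"
    let ?S = "\<lambda>w. \<Sum>b\<in>Poly_Mapping.keys w. s (Poly_Mapping.lookup w b) (f b)"
    have "?S (u + v) = (\<Sum>b\<in>?A. s (Poly_Mapping.lookup (u + v) b) (f b))"
      by (rule *[OF _ Poly_Mapping.keys_add]) simp
    also have "\<dots> = (\<Sum>b\<in>?A. s (Poly_Mapping.lookup u b) (f b)) +
        (\<Sum>b\<in>?A. s (Poly_Mapping.lookup v b) (f b))"
      by (simp add: lookup_add V.scale_left_distrib sum.distrib)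
    also have "(\<Sum>b\<in>?A. s (Poly_Mapping.lookup u b) (f b)) = ?S u"
      by (rule *[symmetric]) auto
    also have "(\<Sum>b\<in>?A. s (Poly_Mapping.lookup v b) (f b)) = ?S v"
      by (rule *[symmetric]) auto
    finally show "?S (u + v) = ?S u + ?S v" .
  next
    fix c :: 'k and v :: "'b \<Rightarrow>\<^sub>0 'k"
    have "Poly_Mapping.keys (fscale c v) \<subseteq> Poly_Mapping.keys v"
      by (auto simp: in_keys_iff)
    then show "(\<Sum>b\<in>Poly_Mapping.keys (fscale c v). s (Poly_Mapping.lookup (fscale c v) b) (f b)) =
        s c (\<Sum>b\<in>Poly_Mapping.keys v. s (Poly_Mapping.lookup v b) (f b))"
      by (subst *[of "Poly_Mapping.keys v" "fscale c v"]) (simp_all add: V.scale_sum_right)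
  qed
qed

lemma linear_lin_ext: "Vector_Spaces.linear fscale fscale (lin_ext f)"
  unfolding lin_ext_def by (rule linear_sum_keys[OF vector_space_fscale])

lemma fscale_basis: "fscale c (Poly_Mapping.single b d) = Poly_Mapping.single b (c * d)"
  by (rule poly_mapping_eqI) (simp add: lookup_single when_def)

lemma lin_ext_basis [simp]: "lin_ext f (basis_elt b) = f b"
  by (rule poly_mapping_eqI) (simp add: lin_ext_def)

lemma linear_eqI:
  fixes s :: "'k::field \<Rightarrow> 'w::ab_group_add \<Rightarrow> 'w"
  assumes f: "Vector_Spaces.linear fscale s f" and g: "Vector_Spaces.linear fscale s g"
    and eq: "\<And>b. f (basis_elt b) = g (basis_elt b)"
  shows "f v = g v"
proof -
  interpret F: Vector_Spaces.linear fscale s f by fact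
  interpret G: Vector_Spaces.linear fscale s g by fact
  have v: "v = (\<Sum>b\<in>Poly_Mapping.keys v. fscale (Poly_Mapping.lookup v b) (basis_elt b))"
    by (rule poly_mapping_eqI)
       (simp add: lookup_sum lookup_single when_def in_keys_iff if_distrib cong: if_cong)
  show ?thesis
    by (subst (1 2) v) (simp add: F.sum F.scale G.sum G.scale eq)
qed

lemma lookup_tensor [simp]:
  "Poly_Mapping.lookup (u \<otimes>\<^sub>v v) (b, c) = Poly_Mapping.lookup u b * Poly_Mapping.lookup v c"
proof -
  have "Poly_Mapping.lookup (u \<otimes>\<^sub>v v) (b, c) =
     (\<Sum>b'\<in>Poly_Mapping.keys u. \<Sum>c'\<in>Poly_Mapping.keys v. if b' = b then (if c' = c then
        Poly_Mapping.lookup u b' * Poly_Mapping.lookup v c' else 0) else 0)"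
    unfolding tensor_def lookup_sum
    by (intro sum.cong refl) (auto simp: lookup_single when_def)
  also have "\<dots> = (\<Sum>b'\<in>Poly_Mapping.keys u. if b' = b then 
        Poly_Mapping.lookup u b' * Poly_Mapping.lookup v c else 0)"
    by (intro sum.cong refl) (auto simp: in_keys_iff)
  also have "\<dots> = Poly_Mapping.lookup u b * Poly_Mapping.lookup v c"
    by (auto simp: in_keys_iff)
  finally show ?thesis .
qed

lemma tensor_basis [simp]: "basis_elt b \<otimes>\<^sub>v basis_elt c = basis_elt (b, c)"
  by (simp add: tensor_def)

lemma tensor_linear_left: "Vector_Spaces.linear fscale fscale (\<lambda>u. u \<otimes>\<^sub>v v)"
  and tensor_linear_right: "Vector_Spaces.linear fscale fscale (\<lambda>v. u \<otimes>\<^sub>v v)"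
  by (auto intro!: Vector_Spaces.linear_iff[THEN iffD2] vector_space_fscale poly_mapping_eqI
      simp: lookup_add algebra_simps)

lemma bilinear_eqI:
  fixes s :: "'k::field \<Rightarrow> 'w::ab_group_add \<Rightarrow> 'w"
  assumes "\<And>v. Vector_Spaces.linear fscale s (\<lambda>u. f u v)" "\<And>u. Vector_Spaces.linear fscale s (f u)"
    and "\<And>v. Vector_Spaces.linear fscale s (\<lambda>u. g u v)" "\<And>u. Vector_Spaces.linear fscale s (g u)"
    and eq: "\<And>b c. f (basis_elt b) (basis_elt c) = g (basis_elt b) (basis_elt c)"
  shows "f u v = g u v"
proof -
  have "f (basis_elt b) v = g (basis_elt b) v" for b
    by (rule linear_eqI[OF assms(2,4)]) (rule eq)
  then show ?thesis by (rule linear_eqI[OF assms(1,3)])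
qed

lemma linear_compose':
  assumes "Vector_Spaces.linear r s f" "Vector_Spaces.linear s t g"
  shows "Vector_Spaces.linear r t (\<lambda>x. g (f x))"
  using Vector_Spaces.linear_compose[OF assms] by (simp add: o_def)

theorem tensor_universal:
  fixes s :: "'k::field \<Rightarrow> 'w::ab_group_add \<Rightarrow> 'w"
    and \<beta> :: "('b \<Rightarrow>\<^sub>0 'k) \<Rightarrow> ('c \<Rightarrow>\<^sub>0 'k) \<Rightarrow> 'w"
  assumes s: "vector_space s"
    and l: "\<And>v. Vector_Spaces.linear fscale s (\<lambda>u. \<beta> u v)"
    and r: "\<And>u. Vector_Spaces.linear fscale s (\<beta> u)"
  shows "\<exists>!\<phi>. Vector_Spaces.linear fscale s \<phi> \<and> (\<forall>u v. \<phi> (u \<otimes>\<^sub>v v) = \<beta> u v)"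
proof (rule ex_ex1I)
  interpret V: vector_space s by fact
  define \<phi> where "\<phi> = (\<lambda>z. \<Sum>p\<in>Poly_Mapping.keys z. s (Poly_Mapping.lookup z p)
      (case p of (b, c) \<Rightarrow> \<beta> (basis_elt b) (basis_elt c)))"
  have lin: "Vector_Spaces.linear fscale s \<phi>"
    unfolding \<phi>_def by (rule linear_sum_keys[OF s])
  have "\<phi> (u \<otimes>\<^sub>v v) = \<beta> u v" for u v
    by (rule bilinear_eqI[where f = "\<lambda>u v. \<phi> (u \<otimes>\<^sub>v v)" and g = \<beta>,
          OF linear_compose'[OF tensor_linear_left lin] linear_compose'[OF tensor_linear_right lin] l r])
       (simp add: \<phi>_def)
  with lin show "\<exists>\<phi>. Vector_Spaces.linear fscale s \<phi> \<and> (\<forall>u v. \<phi> (u \<otimes>\<^sub>v v) = \<beta> u v)"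
    by blast
next
  fix \<phi> \<psi>
  assume a: "Vector_Spaces.linear fscale s \<phi> \<and> (\<forall>u v. \<phi> (u \<otimes>\<^sub>v v) = \<beta> u v)"
    "Vector_Spaces.linear fscale s \<psi> \<and> (\<forall>u v. \<psi> (u \<otimes>\<^sub>v v) = \<beta> u v)"
  show "\<phi> = \<psi>"
  proof
    fix z :: "('b \<times> 'c) \<Rightarrow>\<^sub>0 'k"
    show "\<phi> z = \<psi> z"
    proof (rule linear_eqI[OF a(1)[THEN conjunct1] a(2)[THEN conjunct1]])
      fix p :: "'b \<times> 'c"
      show "\<phi> (basis_elt p) = \<psi> (basis_elt p)"
        using a by (cases p) (metis tensor_basis)
    qed
  qed
qed

lemma tensor_map_tensor:
  assumes f: "Vector_Spaces.linear fscale fscale f" and g: "Vector_Spaces.linear fscale fscale g"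
  shows "tensor_map f g (u \<otimes>\<^sub>v v) = f u \<otimes>\<^sub>v g v"
  by (rule bilinear_eqI[where f = "\<lambda>u v. tensor_map f g (u \<otimes>\<^sub>v v)" and g = "\<lambda>u v. f u \<otimes>\<^sub>v g v"])
     (auto simp: tensor_map_def intro: linear_compose'[OF tensor_linear_left linear_lin_ext]
        linear_compose'[OF tensor_linear_right linear_lin_ext]
        linear_compose'[OF f tensor_linear_left] linear_compose'[OF g tensor_linear_right])

lemma linear_tensor_assoc: "Vector_Spaces.linear fscale fscale tensor_assoc"
  unfolding tensor_assoc_def by (rule linear_lin_ext)

lemma tensor_assoc_tensor: "tensor_assoc ((u \<otimes>\<^sub>v v) \<otimes>\<^sub>v w) = u \<otimes>\<^sub>v (v \<otimes>\<^sub>v w)"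
proof -
  have 1: "tensor_assoc ((u \<otimes>\<^sub>v v) \<otimes>\<^sub>v basis_elt d) = u \<otimes>\<^sub>v (v \<otimes>\<^sub>v basis_elt d)" for d
    unfolding tensor_assoc_def
    by (rule bilinear_eqI[where f = "\<lambda>u v. lin_ext _ ((u \<otimes>\<^sub>v v) \<otimes>\<^sub>v basis_elt d)"
          and g = "\<lambda>u v. u \<otimes>\<^sub>v (v \<otimes>\<^sub>v basis_elt d)",
          OF linear_compose'[OF linear_compose'[OF tensor_linear_left tensor_linear_left] linear_lin_ext]
             linear_compose'[OF linear_compose'[OF tensor_linear_right tensor_linear_left] linear_lin_ext]
             tensor_linear_left linear_compose'[OF tensor_linear_left tensor_linear_right]])
       simp
  show ?thesis
    by (rule linear_eqI[where f = "\<lambda>w. tensor_assoc ((u \<otimes>\<^sub>v v) \<otimes>\<^sub>v w)"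
          and g = "\<lambda>w. u \<otimes>\<^sub>v (v \<otimes>\<^sub>v w)",
          OF linear_compose'[OF tensor_linear_right linear_tensor_assoc]
             linear_compose'[OF tensor_linear_right tensor_linear_right]])
       (rule 1)
qed


section \<open>Finite topologies and their quasi-orders\<close>

definition topologies_on :: "'a set \<Rightarrow> 'a topology set" where
  "topologies_on X = {T. topspace T = X}"

definition le_top :: "'a topology \<Rightarrow> 'a \<Rightarrow> 'a \<Rightarrow> bool" where
  "le_top T x y \<longleftrightarrow> x \<in> topspace T \<and> y \<in> topspace T \<and> (\<forall>U. openin T U \<longrightarrow> x \<in> U \<longrightarrow> y \<in> U)"

definition sim_top :: "'a topology \<Rightarrow> 'a \<Rightarrow> 'a \<Rightarrow> bool" where
  "sim_top T x y \<longleftrightarrow> le_top T x y \<and> le_top T y x"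

definition finer_top :: "'a topology \<Rightarrow> 'a topology \<Rightarrow> bool" (infix \<open>\<prec>\<^sub>t\<close> 50) where
  "T' \<prec>\<^sub>t T \<longleftrightarrow> topspace T' = topspace T \<and> (\<forall>U. openin T U \<longrightarrow> openin T' U)"

definition final_segment_topology :: "'a set \<Rightarrow> ('a \<Rightarrow> 'a \<Rightarrow> bool) \<Rightarrow> 'a topology" where
  "final_segment_topology X Q = topology (\<lambda>U. U \<subseteq> X \<and> (\<forall>x\<in>U. \<forall>y\<in>X. Q x y \<longrightarrow> y \<in> U))"

definition quot_rel :: "'a topology \<Rightarrow> 'a topology \<Rightarrow> 'a \<Rightarrow> 'a \<Rightarrow> bool" where
  "quot_rel T T' x y \<longleftrightarrow> le_top T x y \<or> le_top T' y x"

definition quot_top :: "'a topology \<Rightarrow> 'a topology \<Rightarrow> 'a topology" (infixl \<open>'/\<^sub>t\<close> 70) where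
  "T /\<^sub>t T' = final_segment_topology (topspace T) (quot_rel T T')\<^sup>+\<^sup>+"

definition admissible :: "'a topology \<Rightarrow> 'a topology \<Rightarrow> bool" where
  "admissible T T' \<longleftrightarrow>
     T' \<prec>\<^sub>t T \<and>
     (\<forall>Y. connectedin T' Y \<longrightarrow> subtopology T' Y = subtopology T Y) \<and>
     (\<forall>x\<in>topspace T. \<forall>y\<in>topspace T. sim_top (T /\<^sub>t T') x y \<longleftrightarrow> sim_top (T' /\<^sub>t T') x y)"

lemma openin_final_segment_topology:
  "openin (final_segment_topology X Q) U \<longleftrightarrow> U \<subseteq> X \<and> (\<forall>x\<in>U. \<forall>y\<in>X. Q x y \<longrightarrow> y \<in> U)"
proof -
  have "istopology (\<lambda>U. U \<subseteq> X \<and> (\<forall>x\<in>U. \<forall>y\<in>X. Q x y \<longrightarrow> y \<in> U))"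
    unfolding istopology_def by blast
  then show ?thesis
    by (simp add: final_segment_topology_def topology_inverse')
qed

lemma topspace_final_segment_topology [simp]: "topspace (final_segment_topology X Q) = X"
  unfolding topspace_def openin_final_segment_topology by blast

text \<open>Mutually inverse passages between topologies and quasi-orders on a finite set.\<close>

lemma le_top_final_segment_topology:
  assumes "\<And>x. x \<in> X \<Longrightarrow> Q x x" "\<And>x y z. Q x y \<Longrightarrow> Q y z \<Longrightarrow> Q x z"
  shows "le_top (final_segment_topology X Q) x y \<longleftrightarrow> x \<in> X \<and> y \<in> X \<and> Q x y"
proof
  assume a: "le_top (final_segment_topology X Q) x y"
  then have X: "x \<in> X" "y \<in> X" by (auto simp: le_top_def)
  have "openin (final_segment_topology X Q) {z\<in>X. Q x z}"
    unfolding openin_final_segment_topology using assms(2) by blast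
  with a X assms(1) show "x \<in> X \<and> y \<in> X \<and> Q x y"
    unfolding le_top_def by blast
qed (auto simp: le_top_def openin_final_segment_topology)

lemma final_segment_topology_le_top:
  assumes "finite (topspace T)"
  shows "final_segment_topology (topspace T) (le_top T) = T"
proof (rule topology_eq[THEN iffD2], intro allI iffI)
  fix U assume "openin T U"
  then show "openin (final_segment_topology (topspace T) (le_top T)) U"
    by (auto simp: openin_final_segment_topology le_top_def dest: openin_subset)
next
  fix U assume U: "openin (final_segment_topology (topspace T) (le_top T)) U"
  have "\<exists>V. openin T V \<and> x \<in> V \<and> V \<subseteq> U" if x: "x \<in> U" for x
  proof -
    let ?V = "\<Inter>{W. openin T W \<and> x \<in> W}"
    have xT: "x \<in> topspace T" using U x by (auto simp: openin_final_segment_topology)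
    have fin: "finite {W. openin T W \<and> x \<in> W}"
      by (rule finite_subset[of _ "Pow (topspace T)"]) (use assms in \<open>auto dest: openin_subset\<close>)
    have "openin T ?V"
      by (rule openin_Inter[OF fin]) (use xT in auto)
    moreover have "?V \<subseteq> U"
    proof
      fix y assume "y \<in> ?V"
      then have "le_top T x y" using xT by (auto simp: le_top_def)
      then show "y \<in> U" using U x by (auto simp: openin_final_segment_topology le_top_def)
    qed
    ultimately show ?thesis by blast
  qed
  then show "openin T U" by (subst openin_subopen) blast
qed

lemma topspace_quot_top [simp]: "topspace (T /\<^sub>t T') = topspace T"
  by (simp add: quot_top_def)

lemma le_top_quot_top:
  assumes "topspace T' = topspace T"
  shows "le_top (T /\<^sub>t T') = (quot_rel T T')\<^sup>+\<^sup>+"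
proof (intro ext)
  fix x y
  have "x \<in> topspace T \<and> y \<in> topspace T" if "(quot_rel T T')\<^sup>+\<^sup>+ x y"
    using that by induction (auto simp: quot_rel_def le_top_def assms)
  moreover have "(quot_rel T T')\<^sup>+\<^sup>+ x x" if "x \<in> topspace T" for x
    using that by (intro tranclp.r_into_trancl) (auto simp: quot_rel_def le_top_def)
  ultimately show "le_top (T /\<^sub>t T') x y = (quot_rel T T')\<^sup>+\<^sup>+ x y"
    unfolding quot_top_def by (subst le_top_final_segment_topology) (auto intro: tranclp_trans)
qed

lemma finite_topologies_on:
  assumes "finite X"
  shows "finite (topologies_on X)"
proof (rule finite_imageD)
  show "finite ((\<lambda>T. {U. openin T U}) ` topologies_on X)"
    by (rule finite_subset[of _ "Pow (Pow X)"])
       (use assms in \<open>auto simp: topologies_on_def dest: openin_subset\<close>)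
  show "inj_on (\<lambda>T. {U. openin T U}) (topologies_on X)"
    by (rule inj_onI) (metis mem_Collect_eq topology_eq)
qed


section \<open>The coproduct\<close>

abbreviation top_vs :: "'a set \<Rightarrow> ('a topology \<Rightarrow>\<^sub>0 'k::field) set" where
  "top_vs X \<equiv> free_vs (topologies_on X)"

definition coprod_Gamma ::
    "('a topology \<Rightarrow>\<^sub>0 'k::field) \<Rightarrow> ('a topology \<times> 'a topology \<Rightarrow>\<^sub>0 'k)" where
  "coprod_Gamma = lin_ext (\<lambda>T. \<Sum>T' | admissible T T'. basis_elt T' \<otimes>\<^sub>v basis_elt (T /\<^sub>t T'))"

lemma linear_coprod_Gamma: "Vector_Spaces.linear fscale fscale coprod_Gamma"
  unfolding coprod_Gamma_def by (rule linear_lin_ext)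

lemma coprod_Gamma_basis:
  "coprod_Gamma (basis_elt T) = (\<Sum>T' | admissible T T'. basis_elt T' \<otimes>\<^sub>v basis_elt (T /\<^sub>t T'))"
  unfolding coprod_Gamma_def by (rule lin_ext_basis)

lemma finite_admissible:
  assumes "finite (topspace T)"
  shows "finite {T'. admissible T T'}"
  by (rule finite_subset[OF _ finite_topologies_on[OF assms]])
     (auto simp: admissible_def finer_top_def topologies_on_def)

lemma free_vs_sum: "(\<And>i. i \<in> I \<Longrightarrow> f i \<in> free_vs S) \<Longrightarrow> sum f I \<in> free_vs S"
proof (induction I rule: infinite_finite_induct)
  case (insert i I)
  then show ?case
    using Poly_Mapping.keys_add[of "f i" "sum f I"] by (auto simp: free_vs_def)
qed (auto simp: free_vs_def)

lemma free_vs_scale: "z \<in> free_vs S \<Longrightarrow> fscale c z \<in> free_vs S"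
  by (auto simp: free_vs_def in_keys_iff subset_iff)

lemma coprod_Gamma_in_tensor:
  assumes "v \<in> top_vs X"
  shows "coprod_Gamma v \<in> free_vs (topologies_on X \<times> topologies_on X)"
proof -
  have "basis_elt T' \<otimes>\<^sub>v basis_elt (T /\<^sub>t T') \<in> free_vs (topologies_on X \<times> topologies_on X)"
    if "T \<in> Poly_Mapping.keys v" "admissible T T'" for T T'
    using that assms by (auto simp: free_vs_def admissible_def finer_top_def topologies_on_def)
  then show ?thesis
    unfolding coprod_Gamma_def lin_ext_def by (intro free_vs_sum free_vs_scale) blast
qed

end

theory Submission
  imports Defs
begin

text \<open>
  A \<open>T\<close>-admissible \<open>T'\<close> amounts to the equivalence relation \<open>E\<close> whose classes are the connected
  components of \<open>T'\<close>: the quasi-order of \<open>T'\<close> is \<open>\<le>\<^sub>T \<inter> E\<close>, and that of \<open>T / T'\<close> is the transitive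
  closure of \<open>\<le>\<^sub>T \<union> E\<close>. The relations \<open>E\<close> that occur are those with \<open>\<le>\<^sub>T\<close>-connected classes such that
  every cycle of \<open>\<le>\<^sub>T \<union> E\<close> stays in one class. For two such relations \<open>E \<subseteq> F\<close>, choosing first \<open>F\<close>
  for \<open>T\<close> and then \<open>E\<close> for the restriction to \<open>F\<close> is the same as choosing first \<open>E\<close> for \<open>T\<close> and then
  \<open>F\<close> for the quotient by \<open>E\<close>; this matches the terms of the two iterated coproducts.
\<close>

section \<open>Contractions of a relation\<close>

text \<open>The smallest symmetric and transitive relation containing \<open>R\<close>. It is
  reflexive only at points that \<open>R\<close> relates to something, so no carrier set has to be
  carried along.\<close>

definition conn_rel :: "('a \<Rightarrow> 'a \<Rightarrow> bool) \<Rightarrow> 'a \<Rightarrow> 'a \<Rightarrow> bool" where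
  "conn_rel R = (sup R R\<inverse>\<inverse>)\<^sup>+\<^sup>+"

text \<open>The equation makes \<open>E\<close> symmetric and transitive, with classes connected by
  \<open>L\<close>-steps inside them. The cycle condition says that collapsing the classes
  identifies nothing further.\<close>

definition contraction :: "('a \<Rightarrow> 'a \<Rightarrow> bool) \<Rightarrow> ('a \<Rightarrow> 'a \<Rightarrow> bool) \<Rightarrow> bool" where
  "contraction L E \<longleftrightarrow> conn_rel (inf L E) = E \<and>
     (\<forall>x y. (sup L E)\<^sup>+\<^sup>+ x y \<longrightarrow> (sup L E)\<^sup>+\<^sup>+ y x \<longrightarrow> E x y)"

section \<open>Transitive closures and generated relations\<close>

lemma tranclp_least:
  assumes "R \<le> S" "transp S"
  shows "R\<^sup>+\<^sup>+ \<le> S"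
proof (rule predicate2I)
  fix x y assume "R\<^sup>+\<^sup>+ x y"
  then show "S x y"
    by induction (use assms in \<open>auto dest: transpD\<close>)
qed

lemma transp_tranclp: "transp R\<^sup>+\<^sup>+"
  by (auto intro: transpI tranclp_trans)

lemma tranclp_mono_le: "R \<le> S \<Longrightarrow> R\<^sup>+\<^sup>+ \<le> S\<^sup>+\<^sup>+"
  by (rule tranclp_least[OF _ transp_tranclp]) auto

lemma transp_conn_rel: "transp (conn_rel R)"
  unfolding conn_rel_def by (rule transp_tranclp)

lemma symp_conn_rel: "symp (conn_rel R)"
proof -
  have "(sup R R\<inverse>\<inverse>)\<inverse>\<inverse> = sup R R\<inverse>\<inverse>" by auto
  then show ?thesis
    unfolding conn_rel_def by (metis conversep_iff sympI tranclp_converse)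
qed

lemma conn_rel_greater: "R \<le> conn_rel R"
  unfolding conn_rel_def by auto

lemma conn_rel_least:
  assumes "R \<le> S" "symp S" "transp S"
  shows "conn_rel R \<le> S"
  unfolding conn_rel_def by (rule tranclp_least) (use assms in \<open>auto dest: sympD\<close>)

lemma conn_rel_mono: "R \<le> S \<Longrightarrow> conn_rel R \<le> conn_rel S"
  by (meson conn_rel_greater conn_rel_least order_trans symp_conn_rel transp_conn_rel)

lemma contractionD:
  assumes "contraction L E"
  shows "conn_rel (inf L E) = E" "symp E" "transp E"
    "\<And>x y. (sup L E)\<^sup>+\<^sup>+ x y \<Longrightarrow> (sup L E)\<^sup>+\<^sup>+ y x \<Longrightarrow> E x y"
  using assms unfolding contraction_def by (metis symp_conn_rel transp_conn_rel)+

lemma contractionI: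
  assumes "symp E" "transp E" "E \<le> conn_rel (inf L E)"
    "\<And>x y. (sup L E)\<^sup>+\<^sup>+ x y \<Longrightarrow> (sup L E)\<^sup>+\<^sup>+ y x \<Longrightarrow> E x y"
  shows "contraction L E"
  unfolding contraction_def
  using assms conn_rel_least[of "inf L E" E] by (auto intro!: antisym)

section \<open>Restriction and quotient along nested relations\<close>

text \<open>An \<open>F\<close>-step from \<open>y\<close> back to \<open>x\<close> closes the path
  to a cycle of \<open>L\<close> and \<open>F\<close>, so all its vertices lie in one
  \<open>F\<close>-class and each \<open>L\<close>-step is in \<open>inf L F\<close>. The properties
  of \<open>F\<close> are listed separately so that the lemma also serves where
  \<open>contraction L F\<close> is still to be shown.\<close>

lemma path_between_related:
  assumes F: "symp F" "transp F"
      "\<And>x y. (sup L F)\<^sup>+\<^sup>+ x y \<Longrightarrow> (sup L F)\<^sup>+\<^sup>+ y x \<Longrightarrow> F x y"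
    and EF: "E \<le> F"
    and xy: "(sup L E)\<^sup>+\<^sup>+ x y" "F x y"
  shows "(sup (inf L F) E)\<^sup>+\<^sup>+ x y"
  using xy
proof (induction rule: converse_tranclp_induct)
  case (base x)
  then show ?case by (auto intro: tranclp.r_into_trancl)
next
  case (step x z)
  have le: "(sup L E)\<^sup>+\<^sup>+ \<le> (sup L F)\<^sup>+\<^sup>+"
    by (rule tranclp_mono_le) (use EF in auto)
  have "(sup L F)\<^sup>+\<^sup>+ z y" "(sup L F)\<^sup>+\<^sup>+ x z"
    using le step.hyps by auto
  moreover have "(sup L F)\<^sup>+\<^sup>+ y x"
    using step.prems F(1) by (auto dest: sympD)
  ultimately have xz: "F x z"
    using F(3) by (meson tranclp_trans)
  then have "F z y"
    using step.prems F(1,2) by (meson sympD transpD)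
  then have "(sup (inf L F) E)\<^sup>+\<^sup>+ z y" by (rule step.IH)
  moreover have "sup (inf L F) E x z" using xz step.hyps by auto
  ultimately show ?case by (rule tranclp_into_tranclp2[rotated])
qed

text \<open>Every generating step on the left lies in the transitive relation \<open>F\<close>, and
  \<open>path_between_related\<close> gives the reverse inclusion. This will match the middle tensor
  factors.\<close>

lemma restrict_quotient:
  assumes F: "contraction L F" and EF: "E \<le> F"
  shows "(sup (inf L F) E)\<^sup>+\<^sup>+ = inf ((sup L E)\<^sup>+\<^sup>+) F"
proof (rule antisym)
  have "(sup (inf L F) E)\<^sup>+\<^sup>+ \<le> (sup L E)\<^sup>+\<^sup>+" by (rule tranclp_mono_le) auto
  moreover have "(sup (inf L F) E)\<^sup>+\<^sup>+ \<le> F"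
    by (rule tranclp_least) (use EF contractionD[OF F] in auto)
  ultimately show "(sup (inf L F) E)\<^sup>+\<^sup>+ \<le> inf ((sup L E)\<^sup>+\<^sup>+) F" by simp
  show "inf ((sup L E)\<^sup>+\<^sup>+) F \<le> (sup (inf L F) E)\<^sup>+\<^sup>+"
    using path_between_related[OF contractionD(2-4)[OF F] EF] by auto
qed

text \<open>Since \<open>E\<close> is contained in \<open>F\<close>, adding \<open>E\<close>-steps
  first creates no new reachability. This will match the last tensor factors.\<close>

lemma quotient_quotient:
  assumes "E \<le> F"
  shows "(sup ((sup L E)\<^sup>+\<^sup>+) F)\<^sup>+\<^sup>+ = (sup L F)\<^sup>+\<^sup>+"
proof (rule antisym)
  have "(sup L E)\<^sup>+\<^sup>+ \<le> (sup L F)\<^sup>+\<^sup>+"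
    by (rule tranclp_mono_le) (use assms in auto)
  then show "(sup ((sup L E)\<^sup>+\<^sup>+) F)\<^sup>+\<^sup>+ \<le> (sup L F)\<^sup>+\<^sup>+"
    by (intro tranclp_least transp_tranclp) auto
  show "(sup L F)\<^sup>+\<^sup>+ \<le> (sup ((sup L E)\<^sup>+\<^sup>+) F)\<^sup>+\<^sup>+"
    by (rule tranclp_mono_le) auto
qed

text \<open>\<open>F\<close> is symmetric and transitive, so a relation generated by part of it
  cannot leave \<open>F\<close>.\<close>

lemma contraction_restrict_le:
  assumes "contraction L F" "contraction (inf L F) E"
  shows "E \<le> F"
proof -
  have "conn_rel (inf (inf L F) E) \<le> F"
    by (rule conn_rel_least) (use contractionD[OF assms(1)] in auto)
  then show ?thesis by (simp add: contractionD(1)[OF assms(2)])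
qed

text \<open>An \<open>E\<close>-pair is already a two-step cycle of the quotient order, which the
  cycle condition for \<open>F\<close> forces into one class.\<close>

lemma contraction_quotient_le:
  assumes "contraction L E" "contraction ((sup L E)\<^sup>+\<^sup>+) F"
  shows "E \<le> F"
proof (rule predicate2I)
  fix x y assume "E x y"
  then have "E x y" "E y x" using contractionD(2)[OF assms(1)] by (auto dest: sympD)
  then show "F x y"
    by (intro contractionD(4)[OF assms(2)]) (auto intro!: tranclp.r_into_trancl)
qed

text \<open>A cycle of \<open>L\<close> and \<open>E\<close> is one of \<open>L\<close> and
  \<open>F\<close>, so its endpoints are \<open>F\<close>-related;
  \<open>path_between_related\<close> moves it into \<open>inf L F\<close> and \<open>E\<close>,
  where the cycle condition for \<open>E\<close> applies. For \<open>F\<close> over the quotient,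
  reachability is unchanged by \<open>quotient_quotient\<close>, and the connecting steps only
  increase.\<close>

lemma contraction_restrict_imp_quotient:
  assumes F: "contraction L F" and E: "contraction (inf L F) E"
  shows "contraction L E" "contraction ((sup L E)\<^sup>+\<^sup>+) F"
proof -
  note EF = contraction_restrict_le[OF F E]
  have eq: "inf (inf L F) E = inf L E" using EF by (simp add: inf_assoc inf_absorb2)
  show "contraction L E"
  proof (rule contractionI)
    show "E \<le> conn_rel (inf L E)" using contractionD(1)[OF E] eq by simp
    fix x y assume xy: "(sup L E)\<^sup>+\<^sup>+ x y" "(sup L E)\<^sup>+\<^sup>+ y x"
    have "(sup L E)\<^sup>+\<^sup>+ \<le> (sup L F)\<^sup>+\<^sup>+"
      by (rule tranclp_mono_le) (use EF in auto)
    then have "F x y" "F y x" using xy contractionD(4)[OF F] by blast+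
    then show "E x y"
      using path_between_related[OF contractionD(2-4)[OF F] EF] xy contractionD(4)[OF E] by blast
  qed (use contractionD[OF E] in auto)
  show "contraction ((sup L E)\<^sup>+\<^sup>+) F"
  proof (rule contractionI)
    have "inf L F \<le> inf ((sup L E)\<^sup>+\<^sup>+) F" by auto
    from conn_rel_mono[OF this] show "F \<le> conn_rel (inf ((sup L E)\<^sup>+\<^sup>+) F)"
      by (simp add: contractionD(1)[OF F])
  qed (use contractionD[OF F] quotient_quotient[OF EF] in auto)
qed

text \<open>The main point is connectedness of the \<open>F\<close>-classes: a quotient step inside
  \<open>F\<close> unfolds into steps of \<open>inf L F\<close> and of \<open>E\<close>, and each
  \<open>E\<close>-step is a zigzag of \<open>L\<close> inside \<open>E\<close>, hence inside
  \<open>F\<close>.\<close>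

lemma contraction_quotient_imp_restrict:
  assumes E: "contraction L E" and F: "contraction ((sup L E)\<^sup>+\<^sup>+) F"
  shows "contraction L F" "contraction (inf L F) E"
proof -
  note EF = contraction_quotient_le[OF E F]
  let ?Q = "(sup L E)\<^sup>+\<^sup>+"
  have eq: "inf (inf L F) E = inf L E" using EF by (simp add: inf_assoc inf_absorb2)
  have E_le: "E \<le> conn_rel (inf L F)"
    using conn_rel_mono[of "inf L E" "inf L F"] EF contractionD(1)[OF E] by auto
  have acyclic: "F x y" if "(sup L F)\<^sup>+\<^sup>+ x y" "(sup L F)\<^sup>+\<^sup>+ y x" for x y
    using contractionD(4)[OF F] that unfolding quotient_quotient[OF EF] .
  have "inf ?Q F \<le> (sup (inf L F) E)\<^sup>+\<^sup>+"
    using path_between_related[OF contractionD(2,3)[OF F] acyclic EF] by auto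
  also have "\<dots> \<le> conn_rel (inf L F)"
    by (rule tranclp_least[OF sup_least[OF conn_rel_greater E_le] transp_conn_rel])
  finally have path: "inf ?Q F \<le> conn_rel (inf L F)" .
  show "contraction L F"
  proof (rule contractionI)
    have "conn_rel (inf ?Q F) \<le> conn_rel (inf L F)"
      by (rule conn_rel_least[OF path symp_conn_rel transp_conn_rel])
    then show "F \<le> conn_rel (inf L F)" by (simp add: contractionD(1)[OF F])
  qed (use contractionD(2,3)[OF F] acyclic in auto)
  show "contraction (inf L F) E"
  proof (rule contractionI)
    show "E \<le> conn_rel (inf (inf L F) E)" using contractionD(1)[OF E] eq by simp
    have le: "(sup (inf L F) E)\<^sup>+\<^sup>+ \<le> ?Q" by (rule tranclp_mono_le) auto
    fix x y assume "(sup (inf L F) E)\<^sup>+\<^sup>+ x y" "(sup (inf L F) E)\<^sup>+\<^sup>+ y x"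
    then show "E x y" using le contractionD(4)[OF E] by blast
  qed (use contractionD[OF E] in auto)
qed


section \<open>Admissible topologies as contractions\<close>

lemma le_top_refl: "x \<in> topspace T \<Longrightarrow> le_top T x x"
  by (auto simp: le_top_def)

lemma transp_le_top: "transp (le_top T)"
  by (auto simp: le_top_def intro!: transpI)

lemma le_top_inject:
  assumes "finite (topspace T)" "topspace T' = topspace T" "le_top T' = le_top T"
  shows "T' = T"
  by (metis assms final_segment_topology_le_top)

lemma openin_finite_iff:
  assumes "finite (topspace T)"
  shows "openin T U \<longleftrightarrow> U \<subseteq> topspace T \<and> (\<forall>x\<in>U. \<forall>y. le_top T x y \<longrightarrow> y \<in> U)"
proof -
  have "openin T U \<longleftrightarrow> openin (final_segment_topology (topspace T) (le_top T)) U"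
    by (simp add: final_segment_topology_le_top assms)
  also have "\<dots> \<longleftrightarrow> U \<subseteq> topspace T \<and> (\<forall>x\<in>U. \<forall>y. le_top T x y \<longrightarrow> y \<in> U)"
    unfolding openin_final_segment_topology by (auto simp: le_top_def)
  finally show ?thesis .
qed

lemma finer_top_iff:
  assumes "finite (topspace T)"
  shows "T' \<prec>\<^sub>t T \<longleftrightarrow> topspace T' = topspace T \<and> le_top T' \<le> le_top T"
proof
  assume "T' \<prec>\<^sub>t T"
  then show "topspace T' = topspace T \<and> le_top T' \<le> le_top T"
    by (auto simp: finer_top_def le_top_def)
next
  assume le: "topspace T' = topspace T \<and> le_top T' \<le> le_top T"
  then have "finite (topspace T')" using assms by simp
  with le show "T' \<prec>\<^sub>t T"
    unfolding finer_top_def by (auto simp: openin_finite_iff assms)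
qed

lemma le_top_subtopology:
  "le_top (subtopology T Y) x y \<longleftrightarrow> x \<in> Y \<and> y \<in> Y \<and> le_top T x y"
  unfolding le_top_def openin_subtopology topspace_subtopology by blast

lemma conn_rel_le_top_topspace:
  "conn_rel (le_top T) x y \<Longrightarrow> x \<in> topspace T \<and> y \<in> topspace T"
  unfolding conn_rel_def by (induction rule: tranclp_induct) (auto simp: le_top_def)

text \<open>Supplies the test sets at which the restriction condition of admissibility is
  evaluated.\<close>

lemma connectedin_component:
  "connectedin T {y. conn_rel (le_top T) x y}"
  unfolding connectedin
proof (intro conjI notI)
  let ?Y = "{y. conn_rel (le_top T) x y}"
  show "?Y \<subseteq> topspace T" using conn_rel_le_top_topspace by fast
  assume "\<exists>A B. openin T A \<and> openin T B \<and> ?Y \<subseteq> A \<union> B \<and> A \<inter> B \<inter> ?Y = {} \<and> A \<inter> ?Y \<noteq> {} \<and> B \<inter> ?Y \<noteq> {}"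
  then obtain A B a b where AB: "openin T A" "openin T B" "?Y \<subseteq> A \<union> B" "A \<inter> B \<inter> ?Y = {}"
    and a: "a \<in> A" "a \<in> ?Y" and b: "b \<in> B" "b \<in> ?Y" by blast
  \<comment> \<open>An upward step stays in \<open>A\<close> because \<open>A\<close> is open. A
    downward step out of \<open>A\<close> would land in \<open>B\<close>, and openness of
    \<open>B\<close> would put \<open>w\<close> into \<open>B\<close> as well.\<close>
  have closed: "z \<in> A \<inter> ?Y" if w: "w \<in> A \<inter> ?Y" and wz: "le_top T w z \<or> le_top T z w" for w z
  proof -
    have "conn_rel (le_top T) w z"
      using wz unfolding conn_rel_def by auto
    then have z: "z \<in> ?Y" using w transpD[OF transp_conn_rel] by fast
    have "z \<in> A"
    proof (rule ccontr)
      assume "z \<notin> A"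
      with z AB have "z \<in> B" by blast
      with wz \<open>z \<notin> A\<close> w AB have "w \<in> B" unfolding le_top_def by blast
      with w AB show False by blast
    qed
    with z show ?thesis by blast
  qed
  have "conn_rel (le_top T) a b"
    using a b sympD[OF symp_conn_rel] transpD[OF transp_conn_rel] by fast
  then have "(sup (le_top T) (le_top T)\<inverse>\<inverse>)\<^sup>+\<^sup>+ a b"
    by (simp add: conn_rel_def)
  then have "b \<in> A \<inter> ?Y"
  proof (induction rule: tranclp_induct)
    case (base z)
    show ?case by (rule closed[of a]) (use a base in auto)
  next
    case (step w z)
    show ?case by (rule closed[of w]) (use step in auto)
  qed
  with b AB show False by blast
qed

text \<open>In a finite space the class of \<open>x\<close> and its complement are both final
  segments, hence open, so they would separate \<open>Y\<close>.\<close>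

lemma connectedin_imp_conn_rel:
  assumes fin: "finite (topspace T)" and Y: "connectedin T Y" "x \<in> Y" "y \<in> Y"
  shows "conn_rel (le_top T) x y"
proof (rule ccontr)
  assume not: "\<not> conn_rel (le_top T) x y"
  let ?C = "{y. conn_rel (le_top T) x y}"
  have sub: "Y \<subseteq> topspace T" using Y connectedin_subset_topspace by blast
  have step: "conn_rel (le_top T) x z \<longleftrightarrow> conn_rel (le_top T) x w" if "le_top T z w" for z w
    using that conn_rel_greater[of "le_top T"]
    by (meson predicate2D symp_conn_rel sympD transp_conn_rel transpD)
  have "z \<in> topspace T" if "conn_rel (le_top T) x z" for z
    using conn_rel_le_top_topspace[OF that] by blast
  then have "openin T ?C"
    unfolding openin_finite_iff[OF fin] using step by blast
  moreover have "openin T (topspace T - ?C)"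
    unfolding openin_finite_iff[OF fin] using step by (auto simp: le_top_def)
  moreover have "x \<in> ?C"
    using predicate2D[OF conn_rel_greater[of "le_top T"]] le_top_refl sub Y(2) by fast
  moreover have "Y \<subseteq> ?C \<union> (topspace T - ?C)" using sub by blast
  moreover have "y \<in> topspace T - ?C" using not sub Y(3) by blast
  ultimately show False
    using Y(1)[unfolded connectedin, THEN conjunct2] Y(2,3) by blast
qed

section \<open>Quotient topologies and the translation of admissibility\<close>

lemma le_top_quot_top_self: "le_top (T /\<^sub>t T) = conn_rel (le_top T)"
proof -
  have "quot_rel T T = sup (le_top T) (le_top T)\<inverse>\<inverse>"
    by (intro ext) (auto simp: quot_rel_def)
  then show ?thesis by (simp add: le_top_quot_top conn_rel_def)
qed

text \<open>The definition adds only reversed \<open>T'\<close>-steps; forward ones are already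
  \<open>T\<close>-steps, so whole classes of \<open>T'\<close> become equivalent and may be added
  at once.\<close>

lemma le_top_quot_top_conn_rel:
  assumes "topspace T' = topspace T" "le_top T' \<le> le_top T"
  shows "le_top (T /\<^sub>t T') = (sup (le_top T) (conn_rel (le_top T')))\<^sup>+\<^sup>+"
proof -
  have quot: "quot_rel T T' = sup (le_top T) (le_top T')\<inverse>\<inverse>"
    by (intro ext) (auto simp: quot_rel_def)
  have "conn_rel (le_top T') \<le> (quot_rel T T')\<^sup>+\<^sup>+"
    unfolding conn_rel_def quot by (rule tranclp_mono_le) (use assms(2) in auto)
  moreover have "le_top T \<le> (quot_rel T T')\<^sup>+\<^sup>+" unfolding quot by auto
  ultimately have "(sup (le_top T) (conn_rel (le_top T')))\<^sup>+\<^sup>+ \<le> (quot_rel T T')\<^sup>+\<^sup>+"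
    by (intro tranclp_least transp_tranclp) auto
  moreover have "(quot_rel T T')\<^sup>+\<^sup>+ \<le> (sup (le_top T) (conn_rel (le_top T')))\<^sup>+\<^sup>+"
    unfolding quot
    by (rule tranclp_mono_le)
       (use conn_rel_greater[of "le_top T'"] symp_conn_rel[of "le_top T'"] in \<open>auto dest: sympD\<close>)
  ultimately show ?thesis using le_top_quot_top[OF assms(1)] by auto
qed

text \<open>From left to right, the restriction condition on components gives the intersection
  formula, and the condition on \<open>sim_top\<close> gives the cycle condition. Conversely, a
  \<open>T'\<close>-connected set lies in a single class, on which both quasi-orders agree.\<close>

lemma admissible_iff_contraction:
  assumes fin: "finite (topspace T)"
  shows "admissible T T' \<longleftrightarrow> topspace T' = topspace T \<and>
    le_top T' = inf (le_top T) (conn_rel (le_top T')) \<and>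
    contraction (le_top T) (conn_rel (le_top T'))"
    (is "_ \<longleftrightarrow> _ \<and> ?L' = inf ?L ?E \<and> _")
proof
  assume adm: "admissible T T'"
  then have top: "topspace T' = topspace T" and le: "?L' \<le> ?L"
    by (auto simp: admissible_def finer_top_iff fin)
  have "?L' x y" if "?L x y" "?E x y" for x y
  proof -
    have "subtopology T' {y. ?E x y} = subtopology T {y. ?E x y}"
      using adm connectedin_component[of T' x] unfolding admissible_def by blast
    moreover have "?E x x"
      using that by (meson sympD symp_conn_rel transpD transp_conn_rel)
    ultimately show ?thesis
      using that le_top_subtopology by (metis mem_Collect_eq)
  qed
  then have eq: "?L' = inf ?L ?E"
    using le conn_rel_greater[of ?L'] by (intro antisym) auto
  have "contraction ?L ?E"
  proof (rule contractionI)
    show "?E \<le> conn_rel (inf ?L ?E)" using eq by simp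
    fix x y assume "(sup ?L ?E)\<^sup>+\<^sup>+ x y" "(sup ?L ?E)\<^sup>+\<^sup>+ y x"
    then have "sim_top (T /\<^sub>t T') x y"
      by (simp add: sim_top_def le_top_quot_top_conn_rel top le)
    moreover from this have "x \<in> topspace T" "y \<in> topspace T"
      by (auto simp: sim_top_def le_top_def)
    ultimately have "sim_top (T' /\<^sub>t T') x y" using adm by (simp add: admissible_def)
    then show "?E x y" by (simp add: sim_top_def le_top_quot_top_self)
  qed (simp_all add: symp_conn_rel transp_conn_rel)
  with top eq show "topspace T' = topspace T \<and> ?L' = inf ?L ?E \<and> contraction ?L ?E" by simp
next
  assume a: "topspace T' = topspace T \<and> ?L' = inf ?L ?E \<and> contraction ?L ?E"
  then have top: "topspace T' = topspace T" and eq: "?L' = inf ?L ?E"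
    and c: "contraction ?L ?E" by auto
  have le: "?L' \<le> ?L" by (subst eq) simp
  show "admissible T T'"
    unfolding admissible_def finer_top_iff[OF fin]
  proof (intro conjI top le ballI allI impI)
    fix Y assume Y: "connectedin T' Y"
    have "le_top (subtopology T' Y) = le_top (subtopology T Y)"
    proof (intro ext)
      fix x y
      show "le_top (subtopology T' Y) x y = le_top (subtopology T Y) x y"
        using connectedin_imp_conn_rel[of T' Y x y] Y fin top
        by (subst (1 2) le_top_subtopology, subst eq) auto
    qed
    then show "subtopology T' Y = subtopology T Y"
      by (intro le_top_inject) (auto simp: fin top topspace_subtopology)
  next
    fix x y
    have "sim_top (T /\<^sub>t T') x y \<longleftrightarrow> (sup ?L ?E)\<^sup>+\<^sup>+ x y \<and> (sup ?L ?E)\<^sup>+\<^sup>+ y x"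
      by (simp add: sim_top_def le_top_quot_top_conn_rel top le)
    also have "\<dots> \<longleftrightarrow> ?E x y \<and> ?E y x"
      using contractionD(2,4)[OF c] by (auto dest: sympD)
    finally show "sim_top (T /\<^sub>t T') x y \<longleftrightarrow> sim_top (T' /\<^sub>t T') x y"
      by (simp add: sim_top_def le_top_quot_top_self)
  qed
qed

lemma admissibleD:
  assumes "finite (topspace T)" "admissible T T'"
  shows "topspace T' = topspace T" "le_top T' = inf (le_top T) (conn_rel (le_top T'))"
    "contraction (le_top T) (conn_rel (le_top T'))"
    "le_top (T /\<^sub>t T') = (sup (le_top T) (conn_rel (le_top T')))\<^sup>+\<^sup>+"
proof -
  show top: "topspace T' = topspace T" and eq: "le_top T' = inf (le_top T) (conn_rel (le_top T'))"
    and "contraction (le_top T) (conn_rel (le_top T'))"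
    using assms admissible_iff_contraction by blast+
  have "le_top T' \<le> le_top T" by (subst eq) simp
  then show "le_top (T /\<^sub>t T') = (sup (le_top T) (conn_rel (le_top T')))\<^sup>+\<^sup>+"
    using top by (rule le_top_quot_top_conn_rel[rotated])
qed

lemma admissibleI:
  assumes "finite (topspace T)" "topspace T' = topspace T" "le_top T' = inf (le_top T) E"
    "contraction (le_top T) E"
  shows "admissible T T'" "conn_rel (le_top T') = E"
proof -
  show "conn_rel (le_top T') = E" using assms(3) contractionD(1)[OF assms(4)] by simp
  then show "admissible T T'" using assms by (simp add: admissible_iff_contraction)
qed

text \<open>For a contraction \<open>E\<close> of a finite \<open>T\<close>, this is the admissible
  topology encoded by \<open>E\<close>.\<close>

definition restrict_rel :: "'a topology \<Rightarrow> ('a \<Rightarrow> 'a \<Rightarrow> bool) \<Rightarrow> 'a topology" where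
  "restrict_rel T E = final_segment_topology (topspace T) (inf (le_top T) E)"

lemma topspace_restrict_rel [simp]: "topspace (restrict_rel T E) = topspace T"
  by (simp add: restrict_rel_def)

lemma le_top_restrict_rel:
  assumes "contraction (le_top T) E"
  shows "le_top (restrict_rel T E) = inf (le_top T) E"
proof -
  \<comment> \<open>The cycle condition, applied to the loop at \<open>x\<close>, forces
    \<open>E x x\<close>.\<close>
  have refl: "inf (le_top T) E x x" if "x \<in> topspace T" for x
    using le_top_refl[OF that] contractionD(4)[OF assms, of x x]
    by (auto intro: tranclp.r_into_trancl)
  have trans: "inf (le_top T) E x z" if "inf (le_top T) E x y" "inf (le_top T) E y z" for x y z
    using that contractionD(3)[OF assms] transp_le_top[of T] by (auto dest: transpD)
  show ?thesis
    unfolding restrict_rel_def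
    by (intro ext, subst le_top_final_segment_topology)
       (use refl trans in blast, use trans in blast, auto simp: le_top_def)
qed

text \<open>Forward half of a bijection from pairs \<open>(T', T'')\<close> to pairs
  \<open>(T'', U)\<close>, where \<open>U\<close> is the quotient of \<open>T'\<close> by
  \<open>T''\<close>. The two equations preserve the outer quotient and recover \<open>T'\<close>
  from \<open>U\<close>.\<close>

lemma admissible_tower:
  assumes fin: "finite (topspace T)" and T': "admissible T T'" and T'': "admissible T' T''"
  shows "admissible T T''" "admissible (T /\<^sub>t T'') (T' /\<^sub>t T'')"
    "(T /\<^sub>t T'') /\<^sub>t (T' /\<^sub>t T'') = T /\<^sub>t T'"
    "restrict_rel T (conn_rel (le_top (T' /\<^sub>t T''))) = T'"
proof -
  let ?L = "le_top T" and ?F = "conn_rel (le_top T')" and ?E = "conn_rel (le_top T'')"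
  note D' = admissibleD[OF fin T']
  have fin': "finite (topspace T')" using fin D' by simp
  note D'' = admissibleD[OF fin' T'']
  have cE: "contraction (inf ?L ?F) ?E" using D''(3) D'(2) by simp
  note EF = contraction_restrict_le[OF D'(3) cE]
  note q = contraction_restrict_imp_quotient[OF D'(3) cE]
  have "le_top T'' = inf ?L ?E"
    using D''(2) EF by (subst (asm) D'(2)) (simp add: inf_assoc inf_absorb2)
  then show adm: "admissible T T''"
    using admissibleI(1)[OF fin _ _ q(1)] D'(1) D''(1) by simp
  have Q: "le_top (T /\<^sub>t T'') = (sup ?L ?E)\<^sup>+\<^sup>+" by (rule admissibleD(4)[OF fin adm])
  have "le_top (T' /\<^sub>t T'') = (sup (inf ?L ?F) ?E)\<^sup>+\<^sup>+" using D''(4) D'(2) by simp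
  also have "\<dots> = inf (le_top (T /\<^sub>t T'')) ?F"
    unfolding Q by (rule restrict_quotient[OF D'(3) EF])
  finally have U: "le_top (T' /\<^sub>t T'') = inf (le_top (T /\<^sub>t T'')) ?F" .
  have finQ: "finite (topspace (T /\<^sub>t T''))" using fin by simp
  \<comment> \<open>By \<open>U\<close>, the quotient of \<open>T'\<close> by \<open>T''\<close> is
    the restriction of the quotient of \<open>T\<close> to \<open>?F\<close>, so
    \<open>admissibleI\<close> applies there and returns \<open>?F\<close> as its relation.\<close>
  note I = admissibleI[OF finQ _ U q(2)[folded Q]]
  show admU: "admissible (T /\<^sub>t T'') (T' /\<^sub>t T'')" using I(1) D'(1) by simp
  have conn: "conn_rel (le_top (T' /\<^sub>t T'')) = ?F" using I(2) D'(1) by simp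
  show "(T /\<^sub>t T'') /\<^sub>t (T' /\<^sub>t T'') = T /\<^sub>t T'"
    by (rule le_top_inject)
       (simp_all add: fin admissibleD(4)[OF finQ admU] conn D'(4) Q quotient_quotient[OF EF])
  show "restrict_rel T (conn_rel (le_top (T' /\<^sub>t T''))) = T'"
    unfolding conn
    by (rule le_top_inject)
       (use fin' D'(1) D'(2)[symmetric] le_top_restrict_rel[OF D'(3)] in simp_all)
qed

text \<open>Backward half: the classes of \<open>U\<close> are unions of classes of
  \<open>T''\<close>, and cutting \<open>T\<close> down to them commutes with the quotient by
  \<open>T''\<close>, which therefore returns \<open>U\<close>.\<close>

lemma admissible_quotient:
  assumes fin: "finite (topspace T)" and T'': "admissible T T''" and U: "admissible (T /\<^sub>t T'') U"
  defines "T' \<equiv> restrict_rel T (conn_rel (le_top U))"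
  shows "admissible T T'" "admissible T' T''" "T' /\<^sub>t T'' = U"
proof -
  let ?L = "le_top T" and ?F = "conn_rel (le_top U)" and ?E = "conn_rel (le_top T'')"
  note D'' = admissibleD[OF fin T'']
  have finQ: "finite (topspace (T /\<^sub>t T''))" using fin by simp
  note DU = admissibleD[OF finQ U]
  have cF: "contraction ((sup ?L ?E)\<^sup>+\<^sup>+) ?F" using DU(3) D''(4) by simp
  note EF = contraction_quotient_le[OF D''(3) cF]
  note r = contraction_quotient_imp_restrict[OF D''(3) cF]
  have L': "le_top T' = inf ?L ?F" unfolding T'_def by (rule le_top_restrict_rel[OF r(1)])
  have top': "topspace T' = topspace T" by (simp add: T'_def)
  show "admissible T T'" by (rule admissibleI(1)[OF fin top' L' r(1)])
  have "inf (inf ?L ?F) ?E = inf ?L ?E" using EF by (simp add: inf_assoc inf_absorb2)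
  then have L'': "le_top T'' = inf (le_top T') ?E" using D''(2) L' by simp
  show adm: "admissible T' T''"
    by (rule admissibleI(1)[OF _ _ L'']) (use fin top' D''(1) r(2) L' in simp_all)
  have "le_top (T' /\<^sub>t T'') = (sup (inf ?L ?F) ?E)\<^sup>+\<^sup>+"
    using admissibleD(4)[OF _ adm] fin top' L' by simp
  also have "\<dots> = le_top U"
    using restrict_quotient[OF r(1) EF] DU(2) D''(4) by simp
  finally show "T' /\<^sub>t T'' = U"
    by (intro le_top_inject) (use fin top' DU(1) in simp_all)
qed


section \<open>Coassociativity\<close>

text \<open>Coassociativity on basis elements is established for finite spaces, so agreement is
  tested only on the basis elements from \<open>S\<close>.\<close>

lemma linear_eq_on_free_vs:
  fixes s :: "'k::field \<Rightarrow> 'w::ab_group_add \<Rightarrow> 'w"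
  assumes f: "Vector_Spaces.linear fscale s f" and g: "Vector_Spaces.linear fscale s g"
    and v: "v \<in> free_vs S"
    and eq: "\<And>b. b \<in> S \<Longrightarrow> f (basis_elt b) = g (basis_elt b)"
  shows "f v = g v"
proof -
  interpret F: Vector_Spaces.linear fscale s f by fact
  interpret G: Vector_Spaces.linear fscale s g by fact
  have sum: "v = (\<Sum>b\<in>Poly_Mapping.keys v. fscale (Poly_Mapping.lookup v b) (basis_elt b))"
    by (rule poly_mapping_eqI)
       (simp add: lookup_sum lookup_single when_def in_keys_iff if_distrib cong: if_cong)
  have "f (basis_elt b) = g (basis_elt b)" if "b \<in> Poly_Mapping.keys v" for b
    using that v eq by (auto simp: free_vs_def)
  then show ?thesis
    by (subst (1 2) sum) (simp add: F.sum F.scale G.sum G.scale)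
qed

lemma linear_tensor_map: "Vector_Spaces.linear fscale fscale (tensor_map f g)"
  unfolding tensor_map_def by (rule linear_lin_ext)

lemma linear_sum:
  assumes "Vector_Spaces.linear r s f"
  shows "f (sum h A) = (\<Sum>a\<in>A. f (h a))"
proof -
  interpret Vector_Spaces.linear r s f by fact
  show ?thesis by (rule sum)
qed

lemma tensor_map_basis:
  "tensor_map f g (basis_elt (b, c)) = f (basis_elt b) \<otimes>\<^sub>v g (basis_elt c)"
  by (simp add: tensor_map_def)

lemma tensor_assoc_basis: "tensor_assoc (basis_elt ((b, c), d)) = basis_elt (b, c, d)"
  by (simp add: tensor_assoc_def)

lemma coprod_Gamma_left_basis:
  "tensor_assoc (tensor_map coprod_Gamma id (coprod_Gamma (basis_elt T))) =
     (\<Sum>T' | admissible T T'. \<Sum>T'' | admissible T' T''. basis_elt (T'', T' /\<^sub>t T'', T /\<^sub>t T'))"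
  by (simp add: coprod_Gamma_basis linear_sum[OF linear_tensor_map] tensor_map_basis
      linear_sum[OF tensor_linear_left] linear_sum[OF linear_tensor_assoc] tensor_assoc_basis)

lemma coprod_Gamma_right_basis:
  "tensor_map id coprod_Gamma (coprod_Gamma (basis_elt T)) =
     (\<Sum>T'' | admissible T T''. \<Sum>U | admissible (T /\<^sub>t T'') U. basis_elt (T'', U, (T /\<^sub>t T'') /\<^sub>t U))"
  by (simp add: coprod_Gamma_basis linear_sum[OF linear_tensor_map] tensor_map_basis
      linear_sum[OF tensor_linear_right])

lemma coprod_Gamma_coassoc_basis:
  assumes fin: "finite (topspace T)"
  shows "tensor_assoc (tensor_map coprod_Gamma id (coprod_Gamma (basis_elt T))) =
    tensor_map id coprod_Gamma (coprod_Gamma (basis_elt T))"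
proof -
  let ?A = "SIGMA T':{T'. admissible T T'}. {T''. admissible T' T''}"
  let ?B = "SIGMA T'':{T''. admissible T T''}. {U. admissible (T /\<^sub>t T'') U}"
  have fin_adm: "finite (topspace T')" if "admissible T T'" for T'
    using that fin admissibleD(1) by metis
  have "(\<Sum>T' | admissible T T'. \<Sum>T'' | admissible T' T''. basis_elt (T'', T' /\<^sub>t T'', T /\<^sub>t T')) =
      (\<Sum>(T', T'')\<in>?A. basis_elt (T'', T' /\<^sub>t T'', T /\<^sub>t T'))"
    by (rule sum.Sigma) (use fin fin_adm finite_admissible in auto)
  also have "\<dots> = (\<Sum>(T'', U)\<in>?B. basis_elt (T'', U, (T /\<^sub>t T'') /\<^sub>t U))"
    \<comment> \<open>The map \<open>j\<close> keeps \<open>T''\<close> as first tensor factor and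
      makes the middle factor the new index; \<open>i\<close> rebuilds \<open>T'\<close> from the
      classes of \<open>U\<close>.\<close>
    by (rule sum.reindex_bij_witness[where
          i = "\<lambda>(T'', U). (restrict_rel T (conn_rel (le_top U)), T'')" and
          j = "\<lambda>(T', T''). (T'', T' /\<^sub>t T'')"])
       (auto simp: admissible_tower[OF fin] admissible_quotient[OF fin])
  also have "\<dots> = (\<Sum>T'' | admissible T T''. \<Sum>U | admissible (T /\<^sub>t T'') U.
      basis_elt (T'', U, (T /\<^sub>t T'') /\<^sub>t U))"
    by (rule sum.Sigma[symmetric]) (use fin in \<open>auto intro: finite_admissible\<close>)
  finally show ?thesis
    unfolding coprod_Gamma_left_basis coprod_Gamma_right_basis .
qed

theorem theorem3p1:
  fixes X :: "'a set"
  assumes "finite X"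
  shows "\<forall>v \<in> (top_vs X :: ('a topology \<Rightarrow>\<^sub>0 'k::field) set).
           tensor_assoc (tensor_map coprod_Gamma id (coprod_Gamma v)) = tensor_map id coprod_Gamma (coprod_Gamma v)"
proof
  fix v :: "'a topology \<Rightarrow>\<^sub>0 'k"
  assume "v \<in> top_vs X"
  then show "tensor_assoc (tensor_map coprod_Gamma id (coprod_Gamma v)) =
      tensor_map id coprod_Gamma (coprod_Gamma v)"
  proof (rule linear_eq_on_free_vs[where s = fscale, rotated 2])
    fix T :: "'a topology"
    assume "T \<in> topologies_on X"
    then show "tensor_assoc (tensor_map coprod_Gamma id (coprod_Gamma (basis_elt T :: _ \<Rightarrow>\<^sub>0 'k))) =
        tensor_map id coprod_Gamma (coprod_Gamma (basis_elt T))"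
      using assms by (intro coprod_Gamma_coassoc_basis) (simp add: topologies_on_def)
  qed (rule linear_compose'[OF linear_coprod_Gamma] linear_tensor_map
      linear_compose'[OF linear_tensor_map linear_tensor_assoc])+
qed

end
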